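(* Let a cluster (disk) of radius $\rho>0$ in the plane $\mathbb{P}$ contain $N\ge1$ UEs whose locations are independent and uniformly distributed in the disk, and let a satellite be at altitude $h>0$ above $\mathbb{P}$ with slant range $s_t\ge h$ relative to the cluster center at time $t$. Let $F^{t}_{\chi,\mathrm{M}}$ and $f^{t}_{\chi,\mathrm{M}}$ be the CDF and PDF, as given in the context, of the Doppler shift magnitude at a single uniformly located UE in the cluster. Then the maximum of the Doppler shift magnitudes of the $N$ UEs in the cluster has CDF $$F^{t}_{\chi_{\max},\mathrm{M}}(x)=\left(F^{t}_{\chi,\mathrm{M}}(x)\right)^N$$ and PDF $$f^{t}_{\chi_{\max},\mathrm{M}}(x)=N\left(F^{t}_{\chi,\mathrm{M}}(x)\right)^{N-1}f^{t}_{\chi,\mathrm{M}}(x),\qquad 0\le x<A.$$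
   Context: Setting: UEs (user equipments) lie on a plane $\mathbb{P}$ (flat-earth approximation). The satellite at altitude $h$ has orthogonal projection $\mathcal{P}_t$ (sub-satellite point) on $\mathbb{P}$ at time $t$; $s_t$ is the distance from the satellite to the cluster center, and $\hat R_t=\sqrt{s_t^2-h^2}$. Satellite location and cluster center are fixed. Parameters (positive constants unless stated): carrier frequency $f_c$, speed of light $c$, earth radius $r_E$, orbital radius $r_o=r_E+h$, angular velocities $\omega_s$ (satellite) and $\omega_E$ (earth), orbital inclination $\theta_i\in\mathbb{R}$, $\omega_F=\omega_s+\omega_E\cos\theta_i>0$, and $A=\frac{f_c r_o\omega_F}{c}$. Doppler model: for a UE at distance $z_t$ in $\mathbb{P}$ from $\mathcal{P}_t$, the Doppler shift magnitude is $|\chi_t|=\frac{f_c r_E\omega_F}{c}\,\kappa_t$ with $\kappa_t=\frac{r_o z_t}{r_E\sqrt{h^2+z_t^2}}$ (the flat-earth expression used for the cosine of the elevation angle). Single-UE distribution: for $0\le x<A$, $$F^{t}_{\chi,\mathrm{M}}(x)=F_{\mathrm{M}}\!\left(\tfrac{hx}{\sqrt{A^2-x^2}},\rho\,\big|\,\hat R_t\right),\qquad f^{t}_{\chi,\mathrm{M}}(x)=\tfrac{hA^2}{(A^2-x^2)^{3/2}}\,f_{\mathrm{M}}\!\left(\tfrac{hx}{\sqrt{A^2-x^2}},\rho\,\big|\,\hat R_t\right),$$ where $F_{\mathrm{M}}(r,R|\hat R)=\frac{r^2}{R^2}$ and $f_{\mathrm{M}}(r,R|\hat R)=\frac{2r}{R^2}$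 for $0\le r\le R-\hat R$; for $|R-\hat R|<r\le R+\hat R$, $F_{\mathrm{M}}(r,R|\hat R)=\frac{r^2}{\pi R^2}(\theta^*-\frac12\sin 2\theta^* )+\frac1\pi(\phi^*-\frac12\sin2\phi^* )$ and $f_{\mathrm{M}}(r,R|\hat R)=\frac{2r\theta^*}{\pi R^2}$ with $\theta^*=\cos^{-1}\frac{r^2+\hat R^2-R^2}{2\hat Rr}$, $\phi^*=\cos^{-1}\frac{R^2+\hat R^2-r^2}{2\hat RR}$; for $0\le r\le\hat R-R$ with $\hat R>R$, $F_{\mathrm{M}}=f_{\mathrm{M}}=0$; for $r>R+\hat R$, $F_{\mathrm{M}}=1$, $f_{\mathrm{M}}=0$. *)

theory Defs
  imports "HOL-Probability.Probability"
begin

text \<open>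
  Distance from a fixed point \<open>p\<close> of the plane to a uniformly distributed point of a disk of
  radius \<open>R\<close> whose centre is at distance \<open>Rh\<close> from \<open>p\<close>: CDF and PDF at \<open>r\<close>. The
  second branch of the CDF is the area of the lens common to the two disks, divided by
  \<open>pi * R\<^sup>2\<close>.  For \<open>r < 0\<close> both functions are 0.
\<close>

definition theta_star :: "real \<Rightarrow> real \<Rightarrow> real \<Rightarrow> real" where
  "theta_star r R Rh = arccos ((r\<^sup>2 + Rh\<^sup>2 - R\<^sup>2) / (2 * Rh * r))"

definition phi_star :: "real \<Rightarrow> real \<Rightarrow> real \<Rightarrow> real" where
  "phi_star r R Rh = arccos ((R\<^sup>2 + Rh\<^sup>2 - r\<^sup>2) / (2 * Rh * R))"

definition F_M :: "real \<Rightarrow> real \<Rightarrow> real \<Rightarrow> real" where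
  "F_M r R Rh =
    (if 0 \<le> r \<and> r \<le> R - Rh then r\<^sup>2 / R\<^sup>2
     else if \<bar>R - Rh\<bar> < r \<and> r \<le> R + Rh then
       r\<^sup>2 / (pi * R\<^sup>2) * (theta_star r R Rh - 1 / 2 * sin (2 * theta_star r R Rh))
       + 1 / pi * (phi_star r R Rh - 1 / 2 * sin (2 * phi_star r R Rh))
     else if 0 \<le> r \<and> r \<le> Rh - R then 0
     else if r > R + Rh then 1
     else 0)"

definition f_M :: "real \<Rightarrow> real \<Rightarrow> real \<Rightarrow> real" where
  "f_M r R Rh =
    (if 0 \<le> r \<and> r \<le> R - Rh then 2 * r / R\<^sup>2
     else if \<bar>R - Rh\<bar> < r \<and> r \<le> R + Rh then 2 * r * theta_star r R Rh / (pi * R\<^sup>2)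
     else 0)"

text \<open>
  The Doppler shift magnitude is \<open>A * z / sqrt (h\<^sup>2 + z\<^sup>2)\<close> as a function of the distance \<open>z\<close>
  to the sub-satellite point; \<open>h * x / sqrt (A\<^sup>2 - x\<^sup>2)\<close> is its inverse on \<open>{0..<A}\<close>, and the
  prefactor in \<open>f_chi_M\<close> is the derivative of that inverse.
\<close>

definition F_chi_M :: "real \<Rightarrow> real \<Rightarrow> real \<Rightarrow> real \<Rightarrow> real \<Rightarrow> real" where
  "F_chi_M A h \<rho> Rh x = F_M (h * x / sqrt (A\<^sup>2 - x\<^sup>2)) \<rho> Rh"

definition f_chi_M :: "real \<Rightarrow> real \<Rightarrow> real \<Rightarrow> real \<Rightarrow> real \<Rightarrow> real" where
  "f_chi_M A h \<rho> Rh x =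
     h * A\<^sup>2 / (A\<^sup>2 - x\<^sup>2) powr (3 / 2) * f_M (h * x / sqrt (A\<^sup>2 - x\<^sup>2)) \<rho> Rh"

text \<open>
  Doppler shift magnitude at a point at distance \<open>z\<close> from the sub-satellite point; \<open>kappa\<close> is
  the flat-earth expression for the cosine of the elevation angle.
\<close>

definition kappa :: "real \<Rightarrow> real \<Rightarrow> real \<Rightarrow> real \<Rightarrow> real" where
  "kappa r\<^sub>E r\<^sub>o h z = r\<^sub>o * z / (r\<^sub>E * sqrt (h\<^sup>2 + z\<^sup>2))"

definition doppler_magnitude ::
    "real \<Rightarrow> real \<Rightarrow> real \<Rightarrow> real \<Rightarrow> real \<Rightarrow> real \<Rightarrow> real \<Rightarrow> real" where
  "doppler_magnitude f\<^sub>c c r\<^sub>E r\<^sub>o \<omega>\<^sub>F h z = f\<^sub>c * r\<^sub>E * \<omega>\<^sub>F / c * kappa r\<^sub>E r\<^sub>o h z"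

end

theory Submission imports Defs begin

text \<open>
  The radical axis of two circles cuts the lens common to the two disks into two circular segments;
  each of them has an elementary area, which shows that \<open>F_M\<close> is the CDF of the distance to the
  sub-satellite point.  Differentiating the lens area, the sine terms cancel by the law of sines
  and only \<open>2 * r * theta_star\<close> remains, so \<open>f_M\<close> is the derivative of \<open>F_M\<close> outside a finite set.
  The Doppler shift magnitude is an increasing function of the distance, which carries both facts
  over to a single UE, and by independence the CDF of the maximum is the \<open>N\<close>-th power of the CDF of
  a single UE.  As that CDF is continuous (circles are null sets), the finitely many kinks do not
  matter: the fundamental theorem of calculus identifies its derivative as the density.
\<close>

section \<open>Area of a lens\<close>

lemma Basis_real2: "(Basis :: (real^2) set) = {axis 1 1, axis 2 1}"
  by (auto simp: Basis_vec_def UNIV_2)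

text \<open>Lebesgue measure is determined by its values on open boxes, and the preimage of a box
  under the coordinate map is a product of two intervals. This makes areas in \<open>real^2\<close>
  computable by slicing.\<close>

lemma lborel_real2:
  "(lborel :: (real^2) measure) =
     distr (lborel \<Otimes>\<^sub>M lborel) borel (\<lambda>(x, y). x *\<^sub>R axis 1 1 + y *\<^sub>R axis 2 1)"
    (is "_ = distr _ _ ?T")
proof (rule lborel_eqI)
  fix l u :: "real^2"
  assume le: "\<And>b. b \<in> Basis \<Longrightarrow> l \<bullet> b \<le> u \<bullet> b"
  have T: "?T \<in> borel_measurable (lborel \<Otimes>\<^sub>M lborel)"
    unfolding split_beta' by measurable
  have le': "l$1 \<le> u$1" "l$2 \<le> u$2"
    using le[of "axis 1 1"] le[of "axis 2 1"] by (auto simp: Basis_real2 inner_axis)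
  have "?T -` box l u = {l$1<..<u$1} \<times> {l$2<..<u$2}"
    by (auto simp: mem_box_cart forall_2 axis_def)
  then have "emeasure (distr (lborel \<Otimes>\<^sub>M lborel) borel ?T) (box l u)
      = emeasure (lborel \<Otimes>\<^sub>M lborel) ({l$1<..<u$1} \<times> {l$2<..<u$2})"
    by (subst emeasure_distr[OF T]) (auto simp: space_pair_measure)
  also have "\<dots> = ennreal (u$1 - l$1) * ennreal (u$2 - l$2)"
    using le' by (subst lborel.emeasure_pair_measure_Times) auto
  also have "\<dots> = (\<Prod>b\<in>Basis. (u - l) \<bullet> b)"
    using le' by (auto simp: Basis_real2 inner_axis axis_eq_axis ennreal_mult)
  finally show "emeasure (distr (lborel \<Otimes>\<^sub>M lborel) borel ?T) (box l u) = (\<Prod>b\<in>Basis. (u - l) \<bullet> b)" .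
qed simp

text \<open>The primitive is minus the area of the part of the disk to the right of abscissa
  \<open>x\<close>; the derivative is the length of the vertical chord there.\<close>

lemma has_field_derivative_segment_area:
  assumes "-R < x" "x < R"
  shows "((\<lambda>x. x * sqrt (R\<^sup>2 - x\<^sup>2) - R\<^sup>2 * arccos (x / R))
    has_field_derivative 2 * sqrt (R\<^sup>2 - x\<^sup>2)) (at x)"
proof -
  have R: "R > 0" using assms by linarith
  have *: "R\<^sup>2 - x\<^sup>2 > 0" using assms abs_square_less_1[of "x / R"]
    by (simp add: abs_less_iff power_divide divide_simps R)
  have 1: "-1 < x / R" "x / R < 1" using assms R by (auto simp: field_simps)
  have "sqrt (1 - (x / R)\<^sup>2) = sqrt ((R\<^sup>2 - x\<^sup>2) / R\<^sup>2)"
    using R by (simp add: power_divide diff_divide_distrib)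
  then have s: "sqrt (1 - (x / R)\<^sup>2) = sqrt (R\<^sup>2 - x\<^sup>2) / R"
    using R by (simp add: real_sqrt_divide)
  have sq: "sqrt (R\<^sup>2 - x\<^sup>2) * sqrt (R\<^sup>2 - x\<^sup>2) = R\<^sup>2 - x\<^sup>2" "sqrt (R\<^sup>2 - x\<^sup>2) \<noteq> 0"
    using * by auto
  have "((\<lambda>x. x * sqrt (R\<^sup>2 - x\<^sup>2) - R\<^sup>2 * arccos (x / R)) has_field_derivative
     (sqrt (R\<^sup>2 - x\<^sup>2) + x * (inverse (sqrt (R\<^sup>2 - x\<^sup>2)) / 2 * (- (2 * x)))
       - R\<^sup>2 * (inverse (- sqrt (1 - (x/R)\<^sup>2)) * (1 / R)))) (at x)"
    using * 1 R
    by (auto intro!: derivative_eq_intros DERIV_chain'[OF _ DERIV_real_sqrt]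
        DERIV_chain'[where f="\<lambda>x. x / R" and g=arccos, OF _ DERIV_arccos])
  also have "(sqrt (R\<^sup>2 - x\<^sup>2) + x * (inverse (sqrt (R\<^sup>2 - x\<^sup>2)) / 2 * (- (2 * x)))
       - R\<^sup>2 * (inverse (- sqrt (1 - (x/R)\<^sup>2)) * (1 / R))) = 2 * sqrt (R\<^sup>2 - x\<^sup>2)"
    unfolding s using sq R by (simp add: field_simps power2_eq_square)
  finally show ?thesis .
qed

text \<open>Slicing by vertical lines gives chords of length
  \<open>2 * sqrt (R\<^sup>2 - x\<^sup>2)\<close>, to be integrated over \<open>{c..R}\<close>. The
  result is a sector minus a triangle of signed area, so that \<open>c < 0\<close> is covered as
  well.\<close>

lemma emeasure_circular_segment:
  assumes R: "R > 0" and c: "-R \<le> c" "c \<le> R"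
  shows "emeasure lborel {z :: real^2. norm z \<le> R \<and> c \<le> z$1}
    = ennreal (R\<^sup>2 * arccos (c / R) - c * sqrt (R\<^sup>2 - c\<^sup>2))"
proof -
  let ?T = "\<lambda>(x, y). x *\<^sub>R axis 1 1 + y *\<^sub>R axis 2 1 :: real^2"
  let ?S = "{z :: real^2. norm z \<le> R \<and> c \<le> z$1}"
  let ?S' = "{(x, y). x\<^sup>2 + y\<^sup>2 \<le> R\<^sup>2 \<and> c \<le> x}"
  have T: "?T \<in> borel_measurable (lborel \<Otimes>\<^sub>M lborel)"
    unfolding split_beta' by measurable
  have S: "?S \<in> sets borel"
    by (auto intro!: borel_closed closed_Collect_conj closed_Collect_le continuous_intros)
  have S'_eq: "?T -` ?S = ?S'"
    using R by (auto simp: norm_vec_def L2_set_def sum_2 axis_def real_sqrt_le_iff')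
  have S': "?S' \<in> sets (lborel \<Otimes>\<^sub>M lborel)"
    using measurable_sets[OF T S] unfolding S'_eq by (simp add: space_pair_measure)
  have "emeasure lborel ?S = emeasure (lborel \<Otimes>\<^sub>M lborel) ?S'"
    by (subst lborel_real2, subst emeasure_distr[OF T]) (use S S'_eq in \<open>auto simp: space_pair_measure\<close>)
  also have "\<dots> = (\<integral>\<^sup>+x. emeasure lborel (Pair x -` ?S') \<partial>lborel)"
    by (rule lborel.emeasure_pair_measure_alt[OF S'])
  also have "\<dots> = (\<integral>\<^sup>+x. ennreal (2 * sqrt (R\<^sup>2 - x\<^sup>2)) * indicator {c..R} x \<partial>lborel)"
  proof (rule nn_integral_cong)
    fix x
    show "emeasure lborel (Pair x -` ?S') = ennreal (2 * sqrt (R\<^sup>2 - x\<^sup>2)) * indicator {c..R} x"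
    proof (cases "c \<le> x \<and> x \<le> R")
      case True
      then have "\<bar>x\<bar> \<le> R" using c by linarith
      then have "x\<^sup>2 \<le> R\<^sup>2" using R by (simp add: abs_le_square_iff[symmetric])
      then have "Pair x -` ?S' = {- sqrt (R\<^sup>2 - x\<^sup>2) .. sqrt (R\<^sup>2 - x\<^sup>2)}"
      proof -
        have "\<bar>y\<bar> \<le> sqrt (R\<^sup>2 - x\<^sup>2) \<longleftrightarrow> x\<^sup>2 + y\<^sup>2 \<le> R\<^sup>2" for y
          by (subst real_sqrt_abs[symmetric], subst real_sqrt_le_iff) auto
        then have "y \<in> Pair x -` ?S' \<longleftrightarrow> \<bar>y\<bar> \<le> sqrt (R\<^sup>2 - x\<^sup>2)" for y
          using True by simp
        then show ?thesis by (intro set_eqI) (simp only: abs_le_iff atLeastAtMost_iff, linarith)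
      qed
      with True \<open>x\<^sup>2 \<le> R\<^sup>2\<close> show ?thesis by simp
    next
      case False
      have "R \<ge> x" if "x\<^sup>2 + y\<^sup>2 \<le> R\<^sup>2" for y
        using that R zero_le_power2[of y] by (intro power2_le_imp_le[of x R]) linarith+
      with False have "Pair x -` ?S' = {}" by auto
      with False show ?thesis by auto
    qed
  qed
  also have "\<dots> = ennreal ((R * sqrt (R\<^sup>2 - R\<^sup>2) - R\<^sup>2 * arccos (R / R))
      - (c * sqrt (R\<^sup>2 - c\<^sup>2) - R\<^sup>2 * arccos (c / R)))"
  proof (rule nn_integral_has_integral_lebesgue')
    show "0 \<le> 2 * sqrt (R\<^sup>2 - x\<^sup>2)" if "x \<in> {c..R}" for x
    proof -
      have "x\<^sup>2 \<le> R\<^sup>2" using that c by (auto simp: abs_le_square_iff[symmetric])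
      then show ?thesis by simp
    qed
    show "((\<lambda>x. 2 * sqrt (R\<^sup>2 - x\<^sup>2)) has_integral (R * sqrt (R\<^sup>2 - R\<^sup>2) - R\<^sup>2 * arccos (R / R))
      - (c * sqrt (R\<^sup>2 - c\<^sup>2) - R\<^sup>2 * arccos (c / R))) {c..R}"
    \<comment> \<open>At the end \<open>R\<close>, and at \<open>c\<close> if \<open>c = -R\<close>,
      \<open>arccos\<close> is not differentiable; there the primitive is only required to be
      continuous.\<close>
    proof (rule fundamental_theorem_of_calculus_interior_strong[where S="{}"])
      show "continuous_on {c..R} (\<lambda>x. x * sqrt (R\<^sup>2 - x\<^sup>2) - R\<^sup>2 * arccos (x / R))"
        using R c by (auto intro!: continuous_intros simp: field_simps)
      show "((\<lambda>x. x * sqrt (R\<^sup>2 - x\<^sup>2) - R\<^sup>2 * arccos (x / R)) has_vector_derivative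
         2 * sqrt (R\<^sup>2 - x\<^sup>2)) (at x)" if "x \<in> {c<..<R} - {}" for x
        using has_field_derivative_segment_area[of R x] that c
        by (auto simp: has_real_derivative_iff_has_vector_derivative)
    qed (use c in auto)
  qed
  also have "\<dots> = ennreal (R\<^sup>2 * arccos (c / R) - c * sqrt (R\<^sup>2 - c\<^sup>2))"
    using R by simp
  finally show ?thesis .
qed


text \<open>With the cut at \<open>R * t\<close>, the number \<open>arccos t\<close> is half the
  central angle of the segment. This brings the area into the shape of the summands in the lens
  branch of \<open>F_M\<close>.\<close>

lemma measure_circular_segment:
  assumes R: "R > 0" and t: "-1 \<le> t" "t \<le> 1"
  shows "{z :: real^2. norm z \<le> R \<and> R * t \<le> z$1} \<in> lmeasurable" (is "?S \<in> _")
    and "measure lebesgue {z :: real^2. norm z \<le> R \<and> R * t \<le> z$1}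
      = R\<^sup>2 * (arccos t - 1 / 2 * sin (2 * arccos t))"
proof -
  have cl: "closed ?S"
    by (intro closed_Collect_conj closed_Collect_le continuous_intros)
  have "bounded ?S" by (rule boundedI[of _ R]) auto
  with cl show "?S \<in> lmeasurable" by (simp add: lmeasurable_compact compact_eq_bounded_closed)
  have "R * t \<le> R" "- R \<le> R * t" using mult_left_mono[of t 1 R] mult_left_mono[of "-1" t R] R t by auto
  then have *: "emeasure lborel ?S = ennreal (R\<^sup>2 * arccos t - R * t * sqrt (R\<^sup>2 - (R * t)\<^sup>2))"
    using emeasure_circular_segment[of R "R * t"] R by auto
  have "sqrt (R\<^sup>2 - (R * t)\<^sup>2) = sqrt (R\<^sup>2 * (1 - t\<^sup>2))" by (simp add: algebra_simps)
  also have "\<dots> = R * sin (arccos t)" using R t by (simp add: real_sqrt_mult sin_arccos)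
  finally have e: "sqrt (R\<^sup>2 - (R * t)\<^sup>2) = R * sin (arccos t)" .
  have "sin (2 * arccos t) = 2 * sin (arccos t) * t"
    using t by (simp only: sin_double cos_arccos)
  then have eq: "R\<^sup>2 * arccos t - R * t * sqrt (R\<^sup>2 - (R * t)\<^sup>2) =
      R\<^sup>2 * (arccos t - 1 / 2 * sin (2 * arccos t))"
    unfolding e by (simp add: algebra_simps power2_eq_square)
  \<comment> \<open>The bound sin x \<le> x at \<open>2 * arccos t\<close> makes the closed form
    nonnegative, so \<open>ennreal\<close> does not truncate it.\<close>
  have "arccos t - 1 / 2 * sin (2 * arccos t) \<ge> 0"
    using sin_x_le_x[of "2 * arccos t"] arccos_lbound[of t] t by auto
  then have "measure lborel ?S = R\<^sup>2 * (arccos t - 1 / 2 * sin (2 * arccos t))"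
    using * R unfolding eq measure_def by simp
  then show "measure lebesgue ?S = R\<^sup>2 * (arccos t - 1 / 2 * sin (2 * arccos t))"
    using cl by simp
qed

text \<open>The bounds amount to \<open>(r - d)\<^sup>2 \<le> R\<^sup>2\<close> and
  \<open>R\<^sup>2 \<le> (r + d)\<^sup>2\<close>, the triangle inequalities for sides
  \<open>r\<close>, \<open>d\<close>, \<open>R\<close>. They keep the argument of
  \<open>arccos\<close> inside its domain.\<close>

lemma law_of_cosines_bounds:
  fixes d r R :: real
  assumes "d > 0" "r > 0" "\<bar>R - d\<bar> \<le> r" "r \<le> R + d"
  shows "-1 \<le> (r\<^sup>2 + d\<^sup>2 - R\<^sup>2) / (2 * d * r)" "(r\<^sup>2 + d\<^sup>2 - R\<^sup>2) / (2 * d * r) \<le> 1"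
proof -
  have "(r - d)\<^sup>2 \<le> R\<^sup>2" "R\<^sup>2 \<le> (r + d)\<^sup>2"
    using assms by (auto simp: abs_le_square_iff[symmetric])
  then show "-1 \<le> (r\<^sup>2 + d\<^sup>2 - R\<^sup>2) / (2 * d * r)" "(r\<^sup>2 + d\<^sup>2 - R\<^sup>2) / (2 * d * r) \<le> 1"
    using assms by (auto simp: field_simps power2_eq_square)
qed

text \<open>The vertical line at abscissa \<open>r * t\<close> is the radical axis. To its right the
  disk around 0 lies inside the other disk, to its left the inclusion is reversed, so the lens
  consists of one segment of each disk.\<close>

lemma lens_area_axis:
  fixes d r R :: real
  defines "t \<equiv> (r\<^sup>2 + d\<^sup>2 - R\<^sup>2) / (2 * d * r)" and "s \<equiv> (R\<^sup>2 + d\<^sup>2 - r\<^sup>2) / (2 * d * R)"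
  assumes d: "d > 0" and R: "R > 0" and r: "\<bar>R - d\<bar> \<le> r" "r \<le> R + d" "r > 0"
  shows "cball 0 r \<inter> cball (d *\<^sub>R axis 1 1 :: real^2) R \<in> lmeasurable"
    and "measure lebesgue (cball 0 r \<inter> cball (d *\<^sub>R axis 1 1 :: real^2) R) =
      r\<^sup>2 * (arccos t - 1 / 2 * sin (2 * arccos t)) + R\<^sup>2 * (arccos s - 1 / 2 * sin (2 * arccos s))"
proof -
  let ?e = "d *\<^sub>R axis 1 1 :: real^2"
  let ?A = "{z :: real^2. norm z \<le> r \<and> r * t \<le> z$1}"
  let ?D = "{z :: real^2. norm z \<le> R \<and> R * s \<le> z$1}"
  \<comment> \<open>The segment of the second disk opens to the left; the point reflection sending
    \<open>z\<close> to \<open>?e - z\<close> relates it to a segment in standard position.\<close>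
  let ?B = "(+) ?e ` uminus ` ?D"
  show "cball 0 r \<inter> cball ?e R \<in> lmeasurable"
    by (simp add: lmeasurable_compact compact_Int)
  have t: "-1 \<le> t" "t \<le> 1"
    unfolding t_def using d r by (intro law_of_cosines_bounds; simp)+
  have s: "-1 \<le> s" "s \<le> 1"
    unfolding s_def using d R r by (intro law_of_cosines_bounds; linarith)+
  \<comment> \<open>The signed distances of the two centres from the radical axis add up to
    \<open>d\<close>.\<close>
  have rt: "r * t = (r\<^sup>2 + d\<^sup>2 - R\<^sup>2) / (2 * d)" and Rs: "R * s = d - r * t"
    using d R r unfolding t_def s_def by (auto simp: field_simps power2_eq_square)
  have orth: "orthogonal_transformation (uminus :: real^2 \<Rightarrow> real^2)"
    by (simp add: orthogonal_transformation_def linear_uminus)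
  have A: "?A \<in> lmeasurable" by (rule measure_circular_segment) (use r t in auto)
  have B0: "?D \<in> lmeasurable" by (rule measure_circular_segment) (use R s in auto)
  have B: "?B \<in> lmeasurable"
  proof (rule measurable_translation)
    show "uminus ` ?D \<in> lmeasurable"
      by (rule measurable_orthogonal_image) (rule orth, rule B0)
  qed
  have B_eq: "?B = {z. norm (z - ?e) \<le> R \<and> z$1 \<le> r * t}" (is "_ = ?C")
  proof (intro equalityI subsetI)
    fix z assume "z \<in> ?B" then show "z \<in> ?C" using Rs by (auto simp: axis_def)
  next
    fix z assume z: "z \<in> ?C"
    have "z = ?e + - (?e - z)" "?e - z \<in> ?D"
      using z Rs by (auto simp: axis_def norm_minus_commute)
    then show "z \<in> ?B" by (metis (no_types, lifting) imageI)
  qed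
  \<comment> \<open>The difference of the powers of \<open>z\<close> with respect to the two circles changes sign at the radical axis.\<close>
  have key: "(norm z)\<^sup>2 - r\<^sup>2 - ((norm (z - ?e))\<^sup>2 - R\<^sup>2) = 2 * d * (z$1 - r * t)" for z :: "real^2"
  proof -
    have "(norm w)\<^sup>2 = (w$1)\<^sup>2 + (w$2)\<^sup>2" for w :: "real^2"
      by (simp add: norm_vec_def L2_set_def sum_2)
    then show ?thesis
      unfolding rt using d by (simp add: axis_def power2_eq_square field_simps)
  qed
  have nn: "x\<^sup>2 \<le> y\<^sup>2 \<longleftrightarrow> x \<le> y" if "x \<ge> 0" "y \<ge> 0" for x y :: real
    using that by (simp add: abs_le_square_iff[symmetric])
  have un: "cball 0 r \<inter> cball ?e R = ?A \<union> ?B"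
  proof (rule set_eqI)
    fix z :: "real^2"
    have pm: "r * t \<le> z$1 \<Longrightarrow> 0 \<le> 2 * d * (z$1 - r * t)" "z$1 \<le> r * t \<Longrightarrow> 2 * d * (z$1 - r * t) \<le> 0"
      using d by (auto intro: mult_nonneg_nonpos)
    have "norm (z - ?e) \<le> R" if "norm z \<le> r" "r * t \<le> z$1"
    proof -
      have "(norm z)\<^sup>2 \<le> r\<^sup>2" using that r by (simp add: nn)
      then have "(norm (z - ?e))\<^sup>2 \<le> R\<^sup>2" using key[of z] pm(1) that by linarith
      then show ?thesis using R by (simp add: nn)
    qed
    moreover have "norm z \<le> r" if "norm (z - ?e) \<le> R" "z$1 \<le> r * t"
    proof -
      have "(norm (z - ?e))\<^sup>2 \<le> R\<^sup>2" using that R by (simp add: nn)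
      then have "(norm z)\<^sup>2 \<le> r\<^sup>2" using key[of z] pm(2) that by linarith
      then show ?thesis using r by (simp add: nn)
    qed
    ultimately show "z \<in> cball 0 r \<inter> cball ?e R \<longleftrightarrow> z \<in> ?A \<union> ?B"
      unfolding B_eq by (auto simp: dist_norm norm_minus_commute)
  qed
  \<comment> \<open>The two segments overlap only on the radical axis, a null set, so their areas
    add up.\<close>
  have "negligible {z :: real^2. z \<bullet> axis 1 1 = r * t}"
    by (rule negligible_standard_hyperplane) (simp add: Basis_real2)
  then have "negligible (?A \<inter> ?B)"
    unfolding B_eq by (rule negligible_subset) (auto simp: inner_axis)
  then have "measure lebesgue (?A \<inter> ?B) = 0" by (rule negligible_imp_measure0)
  then have "measure lebesgue (?A \<union> ?B) = measure lebesgue ?A + measure lebesgue ?B"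
    by (simp only: measure_Un3[OF A B])
  also have "measure lebesgue ?B = measure lebesgue ?D"
    by (simp add: measure_translation measure_orthogonal_image[OF orth B0])
  finally show "measure lebesgue (cball 0 r \<inter> cball ?e R) =
      r\<^sup>2 * (arccos t - 1 / 2 * sin (2 * arccos t)) + R\<^sup>2 * (arccos s - 1 / 2 * sin (2 * arccos s))"
    unfolding un using measure_circular_segment(2)[of r t] measure_circular_segment(2)[of R s] r R s t by simp
qed

text \<open>An orthogonal map taking \<open>d *\<^sub>R axis 1 1\<close> to \<open>u - p\<close>,
  followed by the translation by \<open>p\<close>, carries the configuration on the axis to the
  general one; both preserve area.\<close>

lemma lens_area:
  fixes p u :: "real^2" and r R :: real
  defines "d \<equiv> dist p u"
  defines "t \<equiv> (r\<^sup>2 + d\<^sup>2 - R\<^sup>2) / (2 * d * r)" and "s \<equiv> (R\<^sup>2 + d\<^sup>2 - r\<^sup>2) / (2 * d * R)"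
  assumes d: "d > 0" and R: "R > 0" and r: "\<bar>R - d\<bar> \<le> r" "r \<le> R + d" "r > 0"
  shows "measure lborel (cball u R \<inter> cball p r) =
      r\<^sup>2 * (arccos t - 1 / 2 * sin (2 * arccos t)) + R\<^sup>2 * (arccos s - 1 / 2 * sin (2 * arccos s))"
proof -
  let ?e = "d *\<^sub>R axis 1 1 :: real^2"
  let ?L = "cball 0 r \<inter> cball ?e R"
  have "norm ?e = norm (u - p)" using d by (simp add: d_def dist_norm norm_minus_commute)
  then obtain f where f: "orthogonal_transformation f" "f ?e = u - p"
    by (rule orthogonal_transformation_exists)
  have inj: "inj f" and lin: "linear f"
    using f by (auto intro: orthogonal_transformation_inj orthogonal_transformation_linear)
  have "f ` ?L = f ` cball 0 r \<inter> f ` cball ?e R" using inj by (rule image_Int)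
  also have "\<dots> = cball 0 r \<inter> cball (u - p) R"
    using image_orthogonal_transformation_cball[OF f(1)] f lin by (simp add: linear_0)
  finally have "(+) p ` f ` ?L = (+) p ` cball 0 r \<inter> (+) p ` cball (u - p) R"
    by (simp add: image_Int)
  also have "\<dots> = cball u R \<inter> cball p r"
    by (auto simp: cball_translation[symmetric])
  finally have "measure lebesgue (cball u R \<inter> cball p r) = measure lebesgue ((+) p ` f ` ?L)" by simp
  also have "\<dots> = measure lebesgue ?L"
    using lens_area_axis(1)[OF d R r] by (simp add: measure_translation measure_orthogonal_image[OF f(1)])
  finally show ?thesis using lens_area_axis(2)[OF d R r] by (simp add: t_def s_def)
qed

section \<open>Distance to a uniform point of a disk\<close>

text \<open>The four cases mirror the branches of \<open>F_M\<close>: the disk around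
  \<open>p\<close> lies inside the cluster, the disks form a proper lens, they are disjoint or
  externally tangent, or the cluster is covered.\<close>

lemma measure_cball_Int_cball:
  fixes p u :: "real^2"
  assumes R: "R > 0" and r: "r \<ge> 0"
  shows "measure lborel (cball u R \<inter> cball p r) = pi * R\<^sup>2 * F_M r R (dist p u)"
proof -
  let ?d = "dist p u"
  have vol: "measure lborel (cball x e) = pi * e\<^sup>2" if "e \<ge> 0" for x :: "real^2" and e
    using that by (simp add: content_cball unit_ball_vol_numeral)
  consider "r \<le> R - ?d" | "\<not> r \<le> R - ?d" "\<bar>R - ?d\<bar> < r" "r \<le> R + ?d" |
    "\<not> r \<le> R - ?d" "r \<le> ?d - R" | "r > R + ?d"
    by linarith
  then show ?thesis
  proof cases
    case 1
    then have "cball u R \<inter> cball p r = cball p r"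
      by (auto simp: dist_commute) (smt (verit) dist_commute dist_triangle)
    then show ?thesis using 1 r R by (simp add: F_M_def vol)
  next
    case 2
    have d: "?d > 0" using 2 by (smt (verit) zero_le_dist)
    have r': "r > 0" using 2 by linarith
    have "F_M r R ?d = r\<^sup>2 / (pi * R\<^sup>2) * (theta_star r R ?d - 1 / 2 * sin (2 * theta_star r R ?d))
       + 1 / pi * (phi_star r R ?d - 1 / 2 * sin (2 * phi_star r R ?d))"
      using 2 by (simp add: F_M_def)
    then have "pi * R\<^sup>2 * F_M r R ?d = r\<^sup>2 * (theta_star r R ?d - 1 / 2 * sin (2 * theta_star r R ?d))
       + R\<^sup>2 * (phi_star r R ?d - 1 / 2 * sin (2 * phi_star r R ?d))"
      using R by (simp only: distrib_left) (simp add: field_simps)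
    then show ?thesis
      using lens_area[of p u R r, OF d R _ _ r'] 2 unfolding theta_star_def phi_star_def by simp
  next
    case 3
    \<comment> \<open>For \<open>r = ?d - R\<close> the disks still touch, so the intersection need
      not be empty; containment in a circle covers the tangent case too.\<close>
    have "cball u R \<inter> cball p r \<subseteq> sphere p r"
    proof
      fix z assume "z \<in> cball u R \<inter> cball p r"
      moreover have "?d \<le> dist p z + dist u z" by (metis dist_commute dist_triangle)
      ultimately show "z \<in> sphere p r" using 3 by auto
    qed
    then have "negligible (cball u R \<inter> cball p r)"
      by (rule negligible_subset[OF negligible_sphere])
    then have "measure lebesgue (cball u R \<inter> cball p r) = 0"
      by (rule negligible_imp_measure0)
    then show ?thesis using 3 r by (simp add: F_M_def)
  next
    case 4
    have "cball u R \<inter> cball p r = cball u R"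
    proof -
      have "dist p z \<le> r" if "dist u z \<le> R" for z
        using dist_triangle[of p z u] that 4 by linarith
      then show ?thesis by auto
    qed
    moreover have "\<not> r \<le> R - ?d" "\<not> r \<le> ?d - R"
      using 4 R zero_le_dist[of p u] by linarith+
    then have "F_M r R ?d = 1" using 4 by (simp add: F_M_def)
    ultimately show ?thesis using R by (simp add: vol)
  qed
qed

section \<open>Derivative of the lens area\<close>

lemma has_real_derivative_segment_angle:
  assumes "-1 < t" "t < 1"
  shows "((\<lambda>t. arccos t - 1 / 2 * sin (2 * arccos t)) has_real_derivative - 2 * sqrt (1 - t\<^sup>2)) (at t)"
proof -
  have pos: "1 - t\<^sup>2 > 0" using assms abs_square_less_1[of t] by (simp add: abs_less_iff)
  then have sq: "sqrt (1 - t\<^sup>2) * sqrt (1 - t\<^sup>2) = 1 - t\<^sup>2" "sqrt (1 - t\<^sup>2) \<noteq> 0" by auto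
  have c: "cos (2 * arccos t) = 2 * t\<^sup>2 - 1"
    using assms by (simp only: cos_double_cos cos_arccos)
  have "((\<lambda>t. arccos t - 1 / 2 * sin (2 * arccos t)) has_real_derivative
      inverse (- sqrt (1 - t\<^sup>2)) - 1 / 2 * (cos (2 * arccos t) * (2 * inverse (- sqrt (1 - t\<^sup>2))))) (at t)"
    using assms by (auto intro!: derivative_eq_intros DERIV_arccos)
  also have "inverse (- sqrt (1 - t\<^sup>2)) - 1 / 2 * (cos (2 * arccos t) * (2 * inverse (- sqrt (1 - t\<^sup>2))))
     = - 2 * sqrt (1 - t\<^sup>2)"
    unfolding c using sq by (simp add: field_simps power2_eq_square)
  finally show ?thesis .
qed

text \<open>Half the common chord can be computed in either circle, and
  \<open>r * t r + R * s r\<close> is constantly \<open>d\<close>. These two relations cancel all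
  terms but one, which is the length of the arc of the growing circle inside the fixed disk.\<close>

lemma has_real_derivative_lens_area:
  fixes d R r :: real
  defines "t \<equiv> \<lambda>r. (r\<^sup>2 + d\<^sup>2 - R\<^sup>2) / (2 * d * r)" and "s \<equiv> \<lambda>r. (R\<^sup>2 + d\<^sup>2 - r\<^sup>2) / (2 * d * R)"
  assumes d: "d > 0" and R: "R > 0" and r: "\<bar>R - d\<bar> < r" "r < R + d"
  shows "((\<lambda>r. r\<^sup>2 * (arccos (t r) - 1 / 2 * sin (2 * arccos (t r)))
      + R\<^sup>2 * (arccos (s r) - 1 / 2 * sin (2 * arccos (s r))))
    has_real_derivative 2 * r * arccos (t r)) (at r)"
proof -
  let ?g = "\<lambda>t :: real. arccos t - 1 / 2 * sin (2 * arccos t)"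
  have r0: "r > 0" using r by linarith
  have sqs: "x\<^sup>2 < y\<^sup>2" if "\<bar>x\<bar> < y" for x y :: real
    using power_strict_mono[of "\<bar>x\<bar>" y 2] that by simp
  \<comment> \<open>The first pair is equivalent to \<open>s r\<close> lying strictly between -1 and
    1, the second pair to the same for \<open>t r\<close>; \<open>arccos\<close> is differentiable
    only there.\<close>
  have sq: "(R - d)\<^sup>2 < r\<^sup>2" "r\<^sup>2 < (R + d)\<^sup>2" "(r - d)\<^sup>2 < R\<^sup>2" "R\<^sup>2 < (r + d)\<^sup>2"
    using r R d r0 by (auto intro!: sqs)
  have t: "-1 < t r" "t r < 1" and s: "-1 < s r" "s r < 1"
    using sq d R r0 unfolding t_def s_def by (auto simp: field_simps power2_eq_square)
  define t' where "t' = (r\<^sup>2 - d\<^sup>2 + R\<^sup>2) / (2 * d * r\<^sup>2)"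
  define s' where "s' = - r / (d * R)"
  have Dt: "(t has_real_derivative t') (at r)"
    unfolding t_def t'_def using d r0
    by (auto intro!: derivative_eq_intros simp: field_simps power2_eq_square)
  have Ds: "(s has_real_derivative s') (at r)"
    unfolding s_def s'_def using d R
    by (auto intro!: derivative_eq_intros simp: field_simps power2_eq_square)
  have Dgt: "((\<lambda>r. ?g (t r)) has_real_derivative - 2 * sqrt (1 - (t r)\<^sup>2) * t') (at r)"
    using DERIV_chain2[OF has_real_derivative_segment_angle[OF t] Dt] .
  have Dgs: "((\<lambda>r. ?g (s r)) has_real_derivative - 2 * sqrt (1 - (s r)\<^sup>2) * s') (at r)"
    using DERIV_chain2[OF has_real_derivative_segment_angle[OF s] Ds] .
  have "R * sqrt (1 - (s r)\<^sup>2) = sqrt (R\<^sup>2 * (1 - (s r)\<^sup>2))"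
    using R by (simp add: real_sqrt_mult)
  also have "R\<^sup>2 * (1 - (s r)\<^sup>2) = r\<^sup>2 * (1 - (t r)\<^sup>2)"
    unfolding t_def s_def using d R r0
    by (simp add: field_simps power2_eq_square)
  also have "sqrt (r\<^sup>2 * (1 - (t r)\<^sup>2)) = r * sqrt (1 - (t r)\<^sup>2)"
    using r0 by (simp add: real_sqrt_mult)
  finally have sines: "R * sqrt (1 - (s r)\<^sup>2) = r * sqrt (1 - (t r)\<^sup>2)" .
  \<comment> \<open>This is the derivative of the identity
    \<open>r * t r + R * s r = d\<close>.\<close>
  have lin: "t r + r * t' + R * s' = 0"
    unfolding t_def t'_def s'_def using d R r0 by (simp add: field_simps power2_eq_square)
  have sin2: "sin (2 * arccos (t r)) = 2 * sqrt (1 - (t r)\<^sup>2) * t r"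
    using t by (simp only: sin_double cos_arccos sin_arccos less_imp_le)
  have "((\<lambda>r. r\<^sup>2) has_real_derivative 2 * r) (at r)"
    by (auto intro!: derivative_eq_intros)
  from DERIV_add[OF DERIV_mult[OF this Dgt] DERIV_cmult[OF Dgs, of "R\<^sup>2"]]
  show ?thesis
  proof (rule DERIV_cong)
    let ?S = "sqrt (1 - (t r)\<^sup>2)"
    have "R\<^sup>2 * (- 2 * sqrt (1 - (s r)\<^sup>2) * s') = - 2 * R * s' * (R * sqrt (1 - (s r)\<^sup>2))"
      by (simp add: power2_eq_square)
    also have "\<dots> = - 2 * r * ?S * (R * s')" unfolding sines by simp
    also have "R * s' = - t r - r * t'" using lin by linarith
    finally show "2 * r * ?g (t r) + - 2 * ?S * t' * r\<^sup>2 + R\<^sup>2 * (- 2 * sqrt (1 - (s r)\<^sup>2) * s') =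
        2 * r * arccos (t r)"
      unfolding sin2 by (simp add: algebra_simps power2_eq_square)
  qed
qed

text \<open>The excluded values are the end points of the branches. At any other \<open>r\<close> a
  single branch is valid on an open neighbourhood and can be differentiated there.\<close>

lemma F_M_has_real_derivative:
  assumes R: "R > 0" and d: "d \<ge> 0" and r: "r \<notin> {0, R - d, d - R, R + d}"
  shows "((\<lambda>r. F_M r R d) has_real_derivative f_M r R d) (at r)"
proof -
  consider "r < 0" | "0 < r" "r < R - d" | "\<bar>R - d\<bar> < r" "r < R + d" | "0 < r" "r < d - R" | "r > R + d"
    using r by fastforce
  then show ?thesis
  proof cases
    case 1
    show ?thesis
      by (rule has_field_derivative_transform_within_open[where f="\<lambda>_. 0" and S="{..<0}"])
        (use 1 R d in \<open>auto simp: F_M_def f_M_def\<close>)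
  next
    case 2
    have "((\<lambda>r. r\<^sup>2 / R\<^sup>2) has_real_derivative 2 * r / R\<^sup>2) (at r)"
      by (rule DERIV_cdivide) (auto intro!: derivative_eq_intros)
    then have "((\<lambda>r. F_M r R d) has_real_derivative 2 * r / R\<^sup>2) (at r)"
      by (rule has_field_derivative_transform_within_open[where S="{0<..<R - d}"])
        (use 2 in \<open>auto simp: F_M_def\<close>)
    then show ?thesis using 2 by (simp add: f_M_def)
  next
    case 3
    have d': "d > 0" using 3 d by linarith
    from DERIV_cdivide[OF has_real_derivative_lens_area[OF d' R 3], of "pi * R\<^sup>2"]
    have "((\<lambda>r. F_M r R d) has_real_derivative 2 * r * theta_star r R d / (pi * R\<^sup>2)) (at r)"
      unfolding theta_star_def
    proof (rule has_field_derivative_transform_within_open[where S="{\<bar>R - d\<bar><..<R + d}"])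
      fix x assume "x \<in> {\<bar>R - d\<bar><..<R + d}"
      then have "\<not> x \<le> R - d" "\<bar>R - d\<bar> < x" "x \<le> R + d" by auto
      then show "(x\<^sup>2 * (arccos ((x\<^sup>2 + d\<^sup>2 - R\<^sup>2) / (2 * d * x)) - 1 / 2 * sin (2 * arccos ((x\<^sup>2 + d\<^sup>2 - R\<^sup>2) / (2 * d * x))))
        + R\<^sup>2 * (arccos ((R\<^sup>2 + d\<^sup>2 - x\<^sup>2) / (2 * d * R)) - 1 / 2 * sin (2 * arccos ((R\<^sup>2 + d\<^sup>2 - x\<^sup>2) / (2 * d * R))))) / (pi * R\<^sup>2)
        = F_M x R d"
        using R by (simp add: F_M_def theta_star_def phi_star_def add_divide_distrib)
    qed (use 3 in auto)
    moreover have "\<not> r \<le> R - d" using 3 by linarith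
    ultimately show ?thesis using 3 by (simp add: f_M_def)
  next
    case 4
    have "((\<lambda>r. F_M r R d) has_real_derivative 0) (at r)"
      by (rule has_field_derivative_transform_within_open[where f="\<lambda>_. 0" and S="{0<..<d - R}"])
        (use 4 R in \<open>auto simp: F_M_def\<close>)
    then show ?thesis using 4 R by (simp add: f_M_def)
  next
    case 5
    have "((\<lambda>r. F_M r R d) has_real_derivative 0) (at r)"
      by (rule has_field_derivative_transform_within_open[where f="\<lambda>_. 1" and S="{R + d<..}"])
        (use 5 R d in \<open>auto simp: F_M_def\<close>)
    then show ?thesis using 5 d by (simp add: f_M_def)
  qed
qed

lemma f_M_nonneg:
  assumes "R > 0" "d \<ge> 0"
  shows "f_M r R d \<ge> 0"
proof -
  have "0 \<le> theta_star r R d" if "\<bar>R - d\<bar> < r" "r \<le> R + d"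
  proof -
    have "d > 0" "r > 0" using that assms by linarith+
    then show ?thesis
      unfolding theta_star_def using that by (intro arccos_lbound law_of_cosines_bounds) auto
  qed
  then show ?thesis using assms by (auto simp: f_M_def)
qed

lemma f_M_measurable:
  assumes "R > 0" "d \<ge> 0"
  shows "(\<lambda>r. f_M r R d) \<in> borel_measurable borel"
proof -
  \<comment> \<open>Outside \<open>{-1..1}\<close> the value of \<open>arccos\<close> is unspecified, so clip its argument.\<close>
  let ?a = "\<lambda>y :: real. arccos (max (-1) (min 1 y))"
  have a [measurable]: "?a \<in> borel_measurable borel"
    by (intro borel_measurable_continuous_onI continuous_intros) auto
  have "f_M r R d = (if 0 \<le> r \<and> r \<le> R - d then 2 * r / R\<^sup>2
     else if \<bar>R - d\<bar> < r \<and> r \<le> R + d then 2 * r * ?a ((r\<^sup>2 + d\<^sup>2 - R\<^sup>2) / (2 * d * r)) / (pi * R\<^sup>2)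
     else 0)" for r
  proof -
    have "-1 \<le> (r\<^sup>2 + d\<^sup>2 - R\<^sup>2) / (2 * d * r) \<and> (r\<^sup>2 + d\<^sup>2 - R\<^sup>2) / (2 * d * r) \<le> 1"
      if "\<bar>R - d\<bar> < r" "r \<le> R + d"
    proof -
      have "d > 0" "r > 0" using that assms by linarith+
      then show ?thesis using that law_of_cosines_bounds[of d r R] by simp
    qed
    then show ?thesis by (auto simp: f_M_def theta_star_def)
  qed
  then show ?thesis by (simp only:) measurable
qed

section \<open>Densities from derivatives of CDFs\<close>

text \<open>Half-open intervals are stable under intersection and generate the Borel sets, so it
  suffices to compare masses on them. Continuity of the CDF rules out atoms and lets the fundamental
  theorem of calculus pass over the finite set \<open>S\<close>.\<close>

lemma measure_eq_density_of_cdf_derivative: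
  assumes "real_distribution \<mu>" and S: "finite S"
    and g: "g \<in> borel_measurable borel" "\<And>x. g x \<ge> 0"
    and deriv: "\<And>x. x \<notin> S \<Longrightarrow> (cdf \<mu> has_real_derivative g x) (at x)"
    and cont: "\<And>x. isCont (cdf \<mu>) x"
  shows "\<mu> = density lborel (\<lambda>x. ennreal (g x))"
proof (rule measure_eqI_generator_eq[where \<Omega>=UNIV and E="range (\<lambda>(a, b). {a<..b::real})" and A="\<lambda>i. {- real i<..real i}"])
  interpret \<mu>: real_distribution \<mu> by fact
  fix X assume "X \<in> range (\<lambda>(a, b). {a<..b::real})"
  then obtain a b where X: "X = {a<..b}" by auto
  show "emeasure \<mu> X = emeasure (density lborel (\<lambda>x. ennreal (g x))) X"
  proof (cases "a \<le> b")
    case True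
    have "(g has_integral cdf \<mu> b - cdf \<mu> a) {a..b}"
      using S True by (rule fundamental_theorem_of_calculus_interior_strong)
        (use deriv cont in \<open>auto simp: has_real_derivative_iff_has_vector_derivative[symmetric]
           intro!: continuous_at_imp_continuous_on\<close>)
    then have "(\<integral>\<^sup>+x. ennreal (g x) * indicator {a..b} x \<partial>lborel) = ennreal (cdf \<mu> b - cdf \<mu> a)"
      by (intro nn_integral_has_integral_lebesgue' g)
    \<comment> \<open>The integral is over a closed interval while the generator is half-open; the
      end point \<open>a\<close> is a null set.\<close>
    moreover have "AE x in lborel. x \<noteq> a" by (rule AE_lborel_singleton)
    then have "(\<integral>\<^sup>+x. ennreal (g x) * indicator {a..b} x \<partial>lborel) =
        (\<integral>\<^sup>+x. ennreal (g x) * indicator {a<..b} x \<partial>lborel)"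
      by (intro nn_integral_cong_AE) (auto simp: indicator_def elim!: eventually_mono)
    ultimately show ?thesis
      using g True unfolding X by (simp add: emeasure_density \<mu>.emeasure_Ioc)
  qed (simp add: X)
next
  interpret \<mu>: real_distribution \<mu> by fact
  show "emeasure \<mu> {- real i<..real i} \<noteq> \<infinity>" for i :: nat
    by simp
next
  show "(\<Union>i. {- real (i::nat)<..real i}) = UNIV" by (rule UN_Ioc_eq_UNIV)
  show "sets \<mu> = sigma_sets UNIV (range (\<lambda>(a, b). {a<..b}))"
    using real_distribution.events_eq_borel[OF assms(1)] by (simp add: borel_sigma_sets_Ioc)
qed (auto simp: Int_stable_def borel_sigma_sets_Ioc)

section \<open>Doppler shift magnitude\<close>

text \<open>After squaring, both sides say \<open>A\<^sup>2 * w\<^sup>2 \<le> x\<^sup>2 * (h\<^sup>2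
  + w\<^sup>2)\<close>. Hence sublevel sets of the Doppler shift are disks around the sub-satellite
  point.\<close>

lemma flat_doppler_le_iff:
  fixes A h w x :: real
  assumes h: "h > 0" and w: "w \<ge> 0" and x: "0 \<le> x" "x < A"
  shows "A * w / sqrt (h\<^sup>2 + w\<^sup>2) \<le> x \<longleftrightarrow> w \<le> h * x / sqrt (A\<^sup>2 - x\<^sup>2)"
proof -
  have p: "h\<^sup>2 + w\<^sup>2 > 0" using h by (simp add: add_pos_nonneg)
  have q: "A\<^sup>2 - x\<^sup>2 > 0" using x power_strict_mono[of x A 2] by simp
  have nn: "a \<le> b \<longleftrightarrow> a\<^sup>2 \<le> b\<^sup>2" if "a \<ge> 0" "b \<ge> 0" for a b :: real
    using that by (simp add: abs_le_square_iff[symmetric])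
  have "A * w / sqrt (h\<^sup>2 + w\<^sup>2) \<le> x \<longleftrightarrow> A * w \<le> x * sqrt (h\<^sup>2 + w\<^sup>2)"
    using p by (simp add: pos_divide_le_eq)
  also have "\<dots> \<longleftrightarrow> (A * w)\<^sup>2 \<le> (x * sqrt (h\<^sup>2 + w\<^sup>2))\<^sup>2"
    using w x p by (intro nn) auto
  also have "\<dots> \<longleftrightarrow> (w * sqrt (A\<^sup>2 - x\<^sup>2))\<^sup>2 \<le> (h * x)\<^sup>2"
    using p q by (simp add: power_mult_distrib algebra_simps)
  also have "\<dots> \<longleftrightarrow> w * sqrt (A\<^sup>2 - x\<^sup>2) \<le> h * x"
    using w x h q by (intro nn[symmetric]) auto
  also have "\<dots> \<longleftrightarrow> w \<le> h * x / sqrt (A\<^sup>2 - x\<^sup>2)"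
    using q by (simp add: pos_le_divide_eq)
  finally show ?thesis .
qed

text \<open>The altitude is the reason for strictness:
  \<open>\<bar>w\<bar> < sqrt (h\<^sup>2 + w\<^sup>2)\<close>. It makes the CDF equal to 1 from
  \<open>A\<close> on.\<close>

lemma flat_doppler_less:
  fixes A h w :: real
  assumes "h > 0" "A > 0"
  shows "A * w / sqrt (h\<^sup>2 + w\<^sup>2) < A"
proof -
  have "\<bar>w\<bar> < sqrt (h\<^sup>2 + w\<^sup>2)"
    by (subst real_sqrt_abs[symmetric], subst real_sqrt_less_iff) (use assms in auto)
  then have "w < sqrt (h\<^sup>2 + w\<^sup>2)" "sqrt (h\<^sup>2 + w\<^sup>2) > 0" by linarith+
  then show ?thesis using assms by (simp add: pos_divide_less_eq)
qed

text \<open>A shift determines the distance at which it occurs, so level sets lie in circles; this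
  is what continuity of the CDF rests on.\<close>

lemma flat_doppler_inverse:
  fixes A h w :: real
  assumes h: "h > 0" and A: "A > 0"
  defines "x \<equiv> A * w / sqrt (h\<^sup>2 + w\<^sup>2)"
  shows "h * x / sqrt (A\<^sup>2 - x\<^sup>2) = w"
proof -
  define k where "k = h\<^sup>2 + w\<^sup>2"
  have p: "h\<^sup>2 + w\<^sup>2 > 0" using h by (simp add: add_pos_nonneg)
  then have "k > 0" by (simp add: k_def)
  have "x\<^sup>2 = A\<^sup>2 * w\<^sup>2 / k"
    unfolding x_def using p by (simp add: power_divide power_mult_distrib k_def)
  also have "w\<^sup>2 = k - h\<^sup>2" by (simp add: k_def)
  finally have "A\<^sup>2 - x\<^sup>2 = (A * h)\<^sup>2 / k"
    using \<open>k > 0\<close> by (simp add: power_mult_distrib field_simps)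
  then have "sqrt (A\<^sup>2 - x\<^sup>2) = A * h / sqrt (h\<^sup>2 + w\<^sup>2)"
    using h A by (simp add: real_sqrt_divide k_def)
  then show ?thesis unfolding x_def using h A p by simp
qed

text \<open>This direction transports breakpoints: if the inverse sends \<open>x\<close> to a
  breakpoint of \<open>F_M\<close>, then \<open>x\<close> is the Doppler image of that
  breakpoint.\<close>

lemma inverse_flat_doppler:
  fixes A h x :: real
  assumes h: "h > 0" and x: "0 \<le> x" "x < A"
  defines "w \<equiv> h * x / sqrt (A\<^sup>2 - x\<^sup>2)"
  shows "A * w / sqrt (h\<^sup>2 + w\<^sup>2) = x"
proof -
  have q: "A\<^sup>2 - x\<^sup>2 > 0" using x power_strict_mono[of x A 2] by simp
  have "h\<^sup>2 + w\<^sup>2 = (h * A)\<^sup>2 / (A\<^sup>2 - x\<^sup>2)"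
    unfolding w_def using q by (simp add: power_divide power_mult_distrib field_simps)
  then have "sqrt (h\<^sup>2 + w\<^sup>2) = h * A / sqrt (A\<^sup>2 - x\<^sup>2)"
    using h x by (simp add: real_sqrt_divide)
  then show ?thesis unfolding w_def using h x q by simp
qed

lemma has_real_derivative_inverse_flat_doppler:
  fixes A h x :: real
  assumes x: "0 \<le> x" "x < A"
  shows "((\<lambda>x. h * x / sqrt (A\<^sup>2 - x\<^sup>2)) has_real_derivative h * A\<^sup>2 / (A\<^sup>2 - x\<^sup>2) powr (3 / 2)) (at x)"
proof -
  let ?q = "A\<^sup>2 - x\<^sup>2"
  have q: "?q > 0" using x power_strict_mono[of x A 2] by simp
  \<comment> \<open>Splitting the exponent produces the form that the quotient rule yields.\<close>
  have "?q powr (3 / 2) = ?q powr (1 + 1 / 2)" by simp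
  also have "\<dots> = ?q * sqrt ?q" using q by (simp only: powr_add powr_half_sqrt powr_one less_imp_le)
  finally have pw: "?q powr (3 / 2) = ?q * sqrt ?q" .
  have s: "sqrt ?q * sqrt ?q = ?q" "sqrt ?q \<noteq> 0" using q by auto
  have "((\<lambda>x. sqrt (A\<^sup>2 - x\<^sup>2)) has_real_derivative (inverse (sqrt ?q) / 2 * (- (2 * x)))) (at x)"
    by (rule DERIV_chain2[where f=sqrt and g="\<lambda>x. A\<^sup>2 - x\<^sup>2", OF DERIV_real_sqrt[OF q]])
      (auto intro!: derivative_eq_intros)
  from DERIV_divide[OF DERIV_cmult_Id[of h] this s(2)]
  show ?thesis
  proof (rule DERIV_cong)
    have "h * sqrt ?q - h * x * (inverse (sqrt ?q) / 2 * - (2 * x)) = (h * (sqrt ?q * sqrt ?q) + h * x * x) / sqrt ?q"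
      using s(2) by (simp add: field_simps)
    also have "h * (sqrt ?q * sqrt ?q) + h * x * x = h * A\<^sup>2"
      unfolding s by (simp add: algebra_simps power2_eq_square)
    finally show "(h * sqrt ?q - h * x * (inverse (sqrt ?q) / 2 * - (2 * x))) / (sqrt ?q * sqrt ?q) =
        h * A\<^sup>2 / ?q powr (3 / 2)"
      unfolding pw s(1) by (simp add: mult.commute)
  qed
qed

section \<open>Law of the Doppler shift at a single UE\<close>

lemma measure_uniform_cball_Int_cball:
  fixes p u :: "real^2"
  assumes "R > 0" "r \<ge> 0"
  shows "measure (uniform_measure lborel (cball u R)) (cball p r) = F_M r R (dist p u)"
proof -
  have "emeasure lborel (cball u R) = ennreal (pi * R\<^sup>2)"
    using assms by (simp add: emeasure_cball unit_ball_vol_numeral)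
  then show ?thesis
    using assms by (subst measure_uniform_measure)
      (auto simp: measure_cball_Int_cball content_cball unit_ball_vol_numeral)
qed

lemma prob_space_uniform_cball:
  fixes u :: "'a::euclidean_space"
  assumes "R > 0"
  shows "prob_space (uniform_measure lborel (cball u R))"
proof (rule prob_space_uniform_measure)
  have "measure lborel (cball u R) > 0" using assms by (rule content_cball_pos)
  then show "emeasure lborel (cball u R) \<noteq> 0" unfolding measure_def by auto
  show "emeasure lborel (cball u R) \<noteq> \<infinity>" using emeasure_bounded_finite[OF bounded_cball, of u R] by auto
qed

text \<open>This is \<open>doppler_magnitude\<close> after cancelling the earth radius, with the
  remaining constants collected in \<open>A\<close>, the limit of the shift at infinite
  distance.\<close>

definition single_doppler :: "real^2 \<Rightarrow> real \<Rightarrow> real \<Rightarrow> real^2 \<Rightarrow> real" where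
  "single_doppler p A h z = A * dist z p / sqrt (h\<^sup>2 + (dist z p)\<^sup>2)"

definition single_doppler_distr ::
    "real^2 \<Rightarrow> real^2 \<Rightarrow> real \<Rightarrow> real \<Rightarrow> real \<Rightarrow> real measure" where
  "single_doppler_distr p u R A h =
     distr (uniform_measure lborel (cball u R)) borel (single_doppler p A h)"

lemma single_doppler_measurable [measurable]: "single_doppler p A h \<in> borel_measurable borel"
  unfolding single_doppler_def by measurable

lemma measure_single_doppler_distr:
  assumes "S \<in> sets borel"
  shows "measure (single_doppler_distr p u R A h) S = measure (uniform_measure lborel (cball u R)) (single_doppler p A h -` S)"
  unfolding single_doppler_distr_def using assms by (subst measure_distr) auto

context
  fixes p u :: "real^2" and R A h :: real
  assumes R: "R > 0" and A: "A > 0" and h: "h > 0"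
begin

lemma real_distribution_single_doppler: "real_distribution (single_doppler_distr p u R A h)"
  unfolding single_doppler_distr_def
  by (rule prob_space.real_distribution_distr[OF prob_space_uniform_cball[OF R]]) simp

text \<open>For \<open>x\<close> in \<open>{0..<A}\<close> the event is that the UE lies in a disk
  around \<open>p\<close>; all shifts are nonnegative and below \<open>A\<close>, which settles the
  other values of \<open>x\<close>.\<close>

lemma cdf_single_doppler:
  "cdf (single_doppler_distr p u R A h) x =
    (if x < 0 then 0 else if x < A then F_chi_M A h R (dist p u) x else 1)"
proof -
  interpret U: prob_space "uniform_measure lborel (cball u R)" by (rule prob_space_uniform_cball[OF R])
  have cdf: "cdf (single_doppler_distr p u R A h) x = measure (uniform_measure lborel (cball u R)) {z. single_doppler p A h z \<le> x}"
    unfolding cdf_def by (simp add: measure_single_doppler_distr vimage_def)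
  consider "x < 0" | "0 \<le> x" "x < A" | "A \<le> x" by linarith
  then show ?thesis
  proof cases
    case 1
    have "single_doppler p A h z \<ge> 0" for z using A by (simp add: single_doppler_def)
    then have "{z. single_doppler p A h z \<le> x} = {}" using 1 by (auto simp: not_le intro: less_le_trans)
    then show ?thesis using 1 by (simp add: cdf)
  next
    case 2
    have "{z. single_doppler p A h z \<le> x} = cball p (h * x / sqrt (A\<^sup>2 - x\<^sup>2))"
      using flat_doppler_le_iff[OF h _ 2] by (auto simp: single_doppler_def dist_commute)
    moreover have "h * x / sqrt (A\<^sup>2 - x\<^sup>2) \<ge> 0"
      using 2 h power_mono[of x A 2] by simp
    ultimately show ?thesis
      using 2 R by (simp add: cdf measure_uniform_cball_Int_cball F_chi_M_def)
  next
    case 3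
    have "single_doppler p A h z < A" for z
      unfolding single_doppler_def by (rule flat_doppler_less[OF h A])
    then have "single_doppler p A h z \<le> x" for z using 3 by (meson less_imp_le order_trans)
    then have "{z. single_doppler p A h z \<le> x} = UNIV" by simp
    then show ?thesis using 3 A U.prob_space by (simp add: cdf)
  qed
qed

lemma isCont_cdf_single_doppler: "isCont (cdf (single_doppler_distr p u R A h)) x"
proof -
  interpret real_distribution "single_doppler_distr p u R A h" by (rule real_distribution_single_doppler)
  \<comment> \<open>An unattained \<open>x\<close> has an empty level set, so the inclusion holds
    for every \<open>x\<close>, even where the radius has no geometric meaning.\<close>
  have "single_doppler p A h -` {x} \<subseteq> sphere p (h * x / sqrt (A\<^sup>2 - x\<^sup>2))"
    using flat_doppler_inverse[OF h A] by (auto simp: single_doppler_def dist_commute)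
  then have "negligible (single_doppler p A h -` {x})"
    by (rule negligible_subset[OF negligible_sphere])
  moreover have meas: "single_doppler p A h -` {x} \<in> sets borel"
    using measurable_sets[OF single_doppler_measurable, of "{x}"] by simp
  ultimately have "emeasure lborel (single_doppler p A h -` {x}) = 0"
    by (simp add: negligible_iff_emeasure0)
  moreover have "emeasure lborel (cball u R \<inter> single_doppler p A h -` {x}) \<le> emeasure lborel (single_doppler p A h -` {x})"
    using meas by (intro emeasure_mono) auto
  ultimately have "emeasure (uniform_measure lborel (cball u R)) (single_doppler p A h -` {x}) = 0"
    using meas by simp
  then have "measure (single_doppler_distr p u R A h) {x} = 0"
    by (subst measure_single_doppler_distr) (auto simp: measure_def)
  then show ?thesis by (simp add: isCont_cdf)
qed

text \<open>The exceptional points are 0 and \<open>A\<close>, where the formula of the CDF changes,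
  and the Doppler images of the breakpoints of \<open>F_M\<close>. Between them the chain rule
  applies.\<close>

lemma cdf_single_doppler_has_derivative:
  assumes x: "x \<notin> {0, A} \<union> (\<lambda>w. A * w / sqrt (h\<^sup>2 + w\<^sup>2)) ` {R - dist p u, dist p u - R, R + dist p u}"
  shows "(cdf (single_doppler_distr p u R A h) has_real_derivative
    (if 0 \<le> x \<and> x < A then f_chi_M A h R (dist p u) x else 0)) (at x)"
proof -
  let ?q = "\<lambda>x. h * x / sqrt (A\<^sup>2 - x\<^sup>2)"
  consider "x < 0" | "0 < x" "x < A" | "A < x" using x by fastforce
  then show ?thesis
  proof cases
    case 1
    have "(cdf (single_doppler_distr p u R A h) has_real_derivative 0) (at x)"
      by (rule has_field_derivative_transform_within_open[where f="\<lambda>_. 0" and S="{..<0}"])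
        (use 1 in \<open>auto simp: cdf_single_doppler\<close>)
    then show ?thesis using 1 by simp
  next
    case 2
    have inv: "A * ?q x / sqrt (h\<^sup>2 + (?q x)\<^sup>2) = x"
      by (rule inverse_flat_doppler) (use 2 h in auto)
    have "A\<^sup>2 - x\<^sup>2 > 0" using 2 power_strict_mono[of x A 2] by simp
    then have "?q x \<noteq> 0" using 2 h by simp
    moreover have "?q x \<notin> {R - dist p u, dist p u - R, R + dist p u}"
    proof
      assume "?q x \<in> {R - dist p u, dist p u - R, R + dist p u}"
      then have "A * ?q x / sqrt (h\<^sup>2 + (?q x)\<^sup>2) \<in>
          (\<lambda>w. A * w / sqrt (h\<^sup>2 + w\<^sup>2)) ` {R - dist p u, dist p u - R, R + dist p u}"
        by (rule imageI)
      then show False using x unfolding inv by simp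
    qed
    ultimately have "((\<lambda>r. F_M r R (dist p u)) has_real_derivative f_M (?q x) R (dist p u)) (at (?q x))"
      using R by (intro F_M_has_real_derivative) auto
    from DERIV_chain2[OF this has_real_derivative_inverse_flat_doppler[of x A h]]
    have "((\<lambda>x. F_chi_M A h R (dist p u) x) has_real_derivative f_chi_M A h R (dist p u) x) (at x)"
      unfolding F_chi_M_def f_chi_M_def using 2 by (simp add: mult.commute)
    then have "(cdf (single_doppler_distr p u R A h) has_real_derivative f_chi_M A h R (dist p u) x) (at x)"
      by (rule has_field_derivative_transform_within_open[where S="{0<..<A}"])
        (use 2 in \<open>auto simp: cdf_single_doppler\<close>)
    then show ?thesis using 2 by simp
  next
    case 3
    have "(cdf (single_doppler_distr p u R A h) has_real_derivative 0) (at x)"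
      by (rule has_field_derivative_transform_within_open[where f="\<lambda>_. 1" and S="{A<..}"])
        (use 3 A in \<open>auto simp: cdf_single_doppler\<close>)
    then show ?thesis using 3 by simp
  qed
qed

end

section \<open>Maximum over the UEs of the cluster\<close>

theorem corollary4:
  fixes M :: "'a measure"
    and X :: "nat \<Rightarrow> 'a \<Rightarrow> real ^ 2"
    and N :: nat
    and u p :: "real ^ 2"
    and \<rho> h s f\<^sub>c c r\<^sub>E r\<^sub>o \<omega>\<^sub>s \<omega>\<^sub>E \<omega>\<^sub>F \<theta>\<^sub>i A :: real
    and \<chi>max :: "'a \<Rightarrow> real"
  assumes prob: "prob_space M"
    and N: "N \<ge> 1"
    and indep: "prob_space.indep_vars M (\<lambda>_. borel) X {..<N}"
    and uniform: "\<And>i. i < N \<Longrightarrow> distr M borel (X i) = uniform_measure lborel (cball u \<rho>)"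
    and radius: "\<rho> > 0"
    and altitude: "h > 0"
    and slant: "s = dist (p, h) (u, 0 :: real)" "s \<ge> h"
    and pos: "f\<^sub>c > 0" "c > 0" "r\<^sub>E > 0" "\<omega>\<^sub>s > 0" "\<omega>\<^sub>E > 0"
    and orbit: "r\<^sub>o = r\<^sub>E + h"
    and omega: "\<omega>\<^sub>F = \<omega>\<^sub>s + \<omega>\<^sub>E * cos \<theta>\<^sub>i" "\<omega>\<^sub>F > 0"
    and A: "A = f\<^sub>c * r\<^sub>o * \<omega>\<^sub>F / c"
    and max: "\<And>\<xi>. \<chi>max \<xi> =
      (MAX i\<in>{..<N}. doppler_magnitude f\<^sub>c c r\<^sub>E r\<^sub>o \<omega>\<^sub>F h (dist (X i \<xi>) p))"
  shows "(\<forall>x. 0 \<le> x \<and> x < A \<longrightarrow>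
            cdf (distr M borel \<chi>max) x = (F_chi_M A h \<rho> (sqrt (s\<^sup>2 - h\<^sup>2)) x) ^ N)
       \<and> distributed M lborel \<chi>max
            (\<lambda>x. ennreal (if 0 \<le> x \<and> x < A
               then real N * (F_chi_M A h \<rho> (sqrt (s\<^sup>2 - h\<^sup>2)) x) ^ (N - 1)
                      * f_chi_M A h \<rho> (sqrt (s\<^sup>2 - h\<^sup>2)) x
               else 0))"
proof -
  interpret prob_space M by (rule prob)
  define d where "d = dist p u"
  define D where "D = single_doppler p A h"
  define \<nu> where "\<nu> = single_doppler_distr p u \<rho> A h"
  define g where "g x = (if 0 \<le> x \<and> x < A
      then real N * (F_chi_M A h \<rho> d x) ^ (N - 1) * f_chi_M A h \<rho> d x else 0)" for x
  have A_pos: "A > 0" using pos omega altitude by (simp add: A orbit)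
  \<comment> \<open>Pythagoras: the satellite is at height \<open>h\<close> above \<open>p\<close>,
    so \<open>d\<close> is the horizontal distance to the cluster centre.\<close>
  have "s\<^sup>2 - h\<^sup>2 = d\<^sup>2" unfolding slant(1) d_def by (simp add: dist_Pair_Pair dist_real_def)
  then have d: "sqrt (s\<^sup>2 - h\<^sup>2) = d" by (simp add: d_def)
  have X: "X i \<in> borel_measurable M" if "i < N" for i
    using indep that by (auto simp: indep_vars_def)
  have D_meas [measurable]: "D \<in> borel_measurable borel" unfolding D_def by measurable
  have \<chi>: "\<chi>max \<xi> = (MAX i\<in>{..<N}. D (X i \<xi>))" for \<xi>
    unfolding max D_def single_doppler_def doppler_magnitude_def kappa_def A
    using pos by (simp add: mult_ac)
  have fin: "finite {..<N}" "{..<N} \<noteq> {}" using N by (auto simp: lessThan_empty_iff)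
  have [measurable]: "\<chi>max \<in> borel_measurable M"
  proof -
    have "(\<lambda>\<xi>. D (X i \<xi>)) \<in> borel_measurable M" if "i < N" for i
      using measurable_compose[OF X[OF that] D_meas] .
    then show ?thesis unfolding \<chi>[abs_def] by (intro borel_measurable_Max) (auto simp: fin)
  qed
  let ?\<mu> = "distr M borel \<chi>max"
  interpret \<mu>: real_distribution ?\<mu> by (rule real_distribution_distr) simp
  have cdf_\<chi>: "cdf ?\<mu> x = cdf \<nu> x ^ N" for x
  proof -
    have vim: "D -` {..x} \<in> sets borel" using measurable_sets[OF D_meas, of "{..x}"] by simp
    have le_iff: "\<chi>max \<xi> \<le> x \<longleftrightarrow> (\<forall>i<N. D (X i \<xi>) \<le> x)" for \<xi>
      unfolding \<chi> using fin by (subst Max_le_iff) auto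
    have "cdf ?\<mu> x = prob (\<chi>max -` {..x} \<inter> space M)"
      unfolding cdf_def by (subst measure_distr) auto
    also have "\<chi>max -` {..x} \<inter> space M = (\<Inter>i\<in>{..<N}. X i -` (D -` {..x}) \<inter> space M)"
      using fin by (auto simp: le_iff)
    \<comment> \<open>The maximum is at most \<open>x\<close> exactly if every UE lies in the same
      Borel set of positions, so independence factors the probability.\<close>
    also have "prob \<dots> = (\<Prod>i\<in>{..<N}. prob (X i -` (D -` {..x}) \<inter> space M))"
      using indep fin(2,1) vim by (rule indep_varsD_finite)
    also have "\<dots> = (\<Prod>i\<in>{..<N}. cdf \<nu> x)"
    proof (rule prod.cong[OF refl])
      fix i assume "i \<in> {..<N}"
      then have i: "i < N" by simp
      have "prob (X i -` (D -` {..x}) \<inter> space M) = measure (distr M borel (X i)) (D -` {..x})"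
        using X[OF i] vim by (subst measure_distr) auto
      then show "prob (X i -` (D -` {..x}) \<inter> space M) = cdf \<nu> x"
        unfolding uniform[OF i] \<nu>_def cdf_def D_def
        by (simp add: measure_single_doppler_distr)
    qed
    also have "\<dots> = cdf \<nu> x ^ N" by simp
    finally show ?thesis .
  qed
  have cdf_\<nu>: "cdf \<nu> x = (if x < 0 then 0 else if x < A then F_chi_M A h \<rho> d x else 1)" for x
    unfolding \<nu>_def d_def by (rule cdf_single_doppler[OF radius A_pos altitude])
  interpret \<nu>: real_distribution \<nu>
    unfolding \<nu>_def by (rule real_distribution_single_doppler[OF radius A_pos altitude])
  \<comment> \<open>Expressed through \<open>cdf \<nu>\<close>, the power inherits measurability
    from monotonicity and nonnegativity from being a probability, and \<open>g\<close> takes the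
    form of the derivative of an \<open>N\<close>-th power.\<close>
  have g_eq: "g x = real N * cdf \<nu> x ^ (N - 1) * (if 0 \<le> x \<and> x < A then f_chi_M A h \<rho> d x else 0)" for x
    by (simp add: g_def cdf_\<nu>)
  have f_meas [measurable]: "(\<lambda>r. f_M r \<rho> d) \<in> borel_measurable borel"
    by (rule f_M_measurable) (use radius in \<open>auto simp: d_def\<close>)
  have cdf_meas [measurable]: "cdf \<nu> \<in> borel_measurable borel"
    by (rule borel_measurable_mono) (auto intro: monoI \<nu>.cdf_nondecreasing)
  have g_meas [measurable]: "g \<in> borel_measurable borel"
    unfolding g_eq[abs_def] f_chi_M_def by measurable
  have g_nonneg: "g x \<ge> 0" for x
    unfolding g_eq f_chi_M_def
    using altitude radius f_M_nonneg[of \<rho> d] by (auto simp: \<nu>.cdf_nonneg d_def)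
  have dens: "?\<mu> = density lborel (\<lambda>x. ennreal (g x))"
  proof (rule measure_eq_density_of_cdf_derivative)
    \<comment> \<open>Taking the \<open>N\<close>-th power creates no new kinks, so the exceptional
      points of a single UE serve for the maximum as well.\<close>
    let ?S = "{0, A} \<union> (\<lambda>w. A * w / sqrt (h\<^sup>2 + w\<^sup>2)) ` {\<rho> - d, d - \<rho>, \<rho> + d}"
    show "finite ?S" by simp
    have cdf_eq: "cdf ?\<mu> = (\<lambda>x. cdf \<nu> x ^ N)" using cdf_\<chi> by auto
    show "(cdf ?\<mu> has_real_derivative g x) (at x)" if "x \<notin> ?S" for x
      unfolding cdf_eq g_eq \<nu>_def d_def
      by (rule DERIV_cong[OF DERIV_power[OF
            cdf_single_doppler_has_derivative[OF radius A_pos altitude that[unfolded d_def]]]])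
        (simp add: mult_ac)
    show "isCont (cdf ?\<mu>) x" for x
      unfolding cdf_eq \<nu>_def
      by (intro continuous_intros isCont_cdf_single_doppler[OF radius A_pos altitude])
  qed (use g_nonneg \<mu>.real_distribution_axioms in auto)
  \<comment> \<open>\<open>distributed\<close> pushes forward to \<open>lborel\<close>, the CDF was
    computed on \<open>borel\<close>; the two image measures agree because the sets do.\<close>
  have "distr M lborel \<chi>max = ?\<mu>" by (rule distr_cong) auto
  then have "distributed M lborel \<chi>max (\<lambda>x. ennreal (g x))"
    unfolding distributed_def dens by auto
  moreover have "cdf ?\<mu> x = F_chi_M A h \<rho> d x ^ N" if "0 \<le> x \<and> x < A" for x
    using that by (simp add: cdf_\<chi> cdf_\<nu>)
  ultimately show ?thesis unfolding d g_def by blast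
qed

end
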